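(* Let $G$ be a finite group that is either simple or such that all of its proper non-trivial normal subgroups are maximal subgroups of $G$. Let $H$ be a maximal subgroup of $G$ that is not normal in $G$ and is a dihedral group of order at least $6$. Let $\Omega$ be the set of right cosets of $H$ in $G$, on which $G$ acts by right multiplication. Then $RC(G,\Omega)\le 3$.
   Context: Groups act on the right. Let a finite group $G$ act non-trivially on a finite set $\Omega$; $G$ acts entrywise on $\Omega^m$. For $1\le k\le m$ and $I,J\in\Omega^m$, write $I\sim_k J$ if for all $1\le p_1<\dots<p_k\le m$ there is $g\in G$ with $I_{p_i}^g=J_{p_i}$ for all $i\in\{1,\dots,k\}$. The relational complexity $RC(G,\Omega)$ is the least integer $k\ge 2$ such that for all integers $m\ge k$ and all $I,J\in\Omega^m$, $I\sim_k J$ implies $I\sim_m J$. *)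

theory Defs
  imports "HOL-Algebra.Algebra"
begin

definition maximal_subgroup :: "'a set \<Rightarrow> ('a, 'c) monoid_scheme \<Rightarrow> bool" where
  "maximal_subgroup M G \<longleftrightarrow>
     subgroup M G \<and> M \<noteq> carrier G \<and>
     (\<forall>K. subgroup K G \<and> M \<subseteq> K \<longrightarrow> K = M \<or> K = carrier G)"

text \<open>
  The dihedral group of order \<open>2 * n\<close>, for \<open>n \<ge> 1\<close>, as the semidirect product of the cyclic
  group of integers modulo \<open>n\<close> by a group of order 2 acting by inversion: with \<open>r\<close> a rotation
  and \<open>s\<close> a reflection, the pair \<open>(i, e)\<close> stands for the element \<open>r^i * s\<close> if \<open>e\<close> holds and
  for \<open>r^i\<close> otherwise, and \<open>s * r^j = r^(-j) * s\<close>.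
\<close>

definition dihedral_group :: "nat \<Rightarrow> (int \<times> bool) monoid" where
  "dihedral_group n =
     \<lparr> carrier = {0..<int n} \<times> UNIV,
       monoid.mult = (\<lambda>(i, d) (j, e). ((if d then i - j else i + j) mod int n, d \<noteq> e)),
       one = (0, False) \<rparr>"

lemma group_dihedral_group:
  assumes "n \<ge> 1"
  shows "group (dihedral_group n)"
proof (rule groupI)
  fix x assume "x \<in> carrier (dihedral_group n)"
  then obtain i d where x: "x = (i, d)" "0 \<le> i" "i < int n"
    by (auto simp: dihedral_group_def)
  have "(if d then i else (- i) mod int n, d) \<in> carrier (dihedral_group n)"
    using x by (auto simp: dihedral_group_def)
  moreover have "(if d then i else (- i) mod int n, d) \<otimes>\<^bsub>dihedral_group n\<^esub> x = \<one>\<^bsub>dihedral_group n\<^esub>"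
    using x by (auto simp: dihedral_group_def mod_add_left_eq)
  ultimately show "\<exists>y\<in>carrier (dihedral_group n). y \<otimes>\<^bsub>dihedral_group n\<^esub> x = \<one>\<^bsub>dihedral_group n\<^esub>"
    by blast
qed (use assms in \<open>auto simp: dihedral_group_def mod_simps algebra_simps\<close>)

lemma order_dihedral_group: "order (dihedral_group n) = 2 * n"
  by (simp add: order_def dihedral_group_def card_cartesian_product)

definition is_dihedral :: "('a, 'c) monoid_scheme \<Rightarrow> bool" where
  "is_dihedral G \<longleftrightarrow> (\<exists>n\<ge>1. G \<cong> dihedral_group n)"

text \<open>
  In the following, \<open>act x g\<close> is the image of the point \<open>x\<close> under the right action of \<open>g\<close>.
  An \<open>m\<close>-tuple of points is an extensional function on \<open>{1..m}\<close>, and the choice of indices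
  \<open>p\<^sub>1 < \<dots> < p\<^sub>k\<close> is a strictly increasing function \<open>p\<close> from \<open>{1..k}\<close> to \<open>{1..m}\<close>.
\<close>

definition tuples :: "'b set \<Rightarrow> nat \<Rightarrow> (nat \<Rightarrow> 'b) set" where
  "tuples \<Omega> m = {1..m} \<rightarrow>\<^sub>E \<Omega>"

definition subtuple_equiv ::
  "('a, 'c) monoid_scheme \<Rightarrow> ('b \<Rightarrow> 'a \<Rightarrow> 'b) \<Rightarrow> nat \<Rightarrow> nat \<Rightarrow> (nat \<Rightarrow> 'b) \<Rightarrow> (nat \<Rightarrow> 'b) \<Rightarrow> bool" where
  "subtuple_equiv G act m k I J \<longleftrightarrow>
     (\<forall>p. p \<in> {1..k} \<rightarrow> {1..m} \<and> strict_mono_on {1..k} p \<longrightarrow>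
        (\<exists>g\<in>carrier G. \<forall>i\<in>{1..k}. act (I (p i)) g = J (p i)))"

text \<open>
  For an action of a group on a finite set the least integer below exists, since
  \<open>k = max 2 (card \<Omega>)\<close> satisfies the condition.
\<close>

definition relational_complexity ::
  "('a, 'c) monoid_scheme \<Rightarrow> ('b \<Rightarrow> 'a \<Rightarrow> 'b) \<Rightarrow> 'b set \<Rightarrow> nat" where
  "relational_complexity G act \<Omega> =
     (LEAST k. k \<ge> 2 \<and>
        (\<forall>m\<ge>k. \<forall>I\<in>tuples \<Omega> m. \<forall>J\<in>tuples \<Omega> m.
           subtuple_equiv G act m k I J \<longrightarrow> subtuple_equiv G act m m I J))"

end

theory Submission
  imports Defs
begin

text \<open>
  By the hypothesis on normal subgroups, \<open>H\<close> contains no non-trivial normal subgroup of \<open>G\<close>.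
  If \<open>c\<close> is a non-trivial rotation in a point stabiliser \<open>K\<close>, then \<open>K\<close> normalises \<open>{c, c\<inverse>}\<close>,
  so by maximality \<open>K\<close> is determined by \<open>c\<close>. Hence the rotation groups of distinct point
  stabilisers intersect trivially, and two-point stabilisers have exponent 2. Moreover, of two
  distinct commuting involutions \<open>t\<close>, \<open>b\<close> in the stabiliser of \<open>x\<close>, one of \<open>t\<close>, \<open>b\<close>, \<open>t b\<close> is the
  central involution \<open>z x\<close>, whose centraliser is the stabiliser of \<open>x\<close>.

  Let \<open>I\<close> and \<open>J\<close> be 3-equivalent. If some two-point stabiliser of entries of \<open>I\<close> is \<open>{1, t}\<close> and
  \<open>t\<close> moves a third entry, make \<open>I\<close> and \<open>J\<close> agree at these three entries. A further entry at which
  they differ would give commuting involutions \<open>a = t\<close>, \<open>b\<close>, \<open>c\<close> in the three two-point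
  stabilisers; these produce central involutions \<open>z x\<close> and \<open>z y\<close> that commute, so both equal \<open>t\<close>
  and \<open>x = y\<close>. If \<open>t\<close> moves no entry, agreement at two entries suffices. If all two-point
  stabilisers have order 4, each is \<open>{1, z x, z y, z x z y}\<close> and fixes every entry.
\<close>

section \<open>Commuting elements and enumerations of index sets\<close>

lemma (in group) involutions_commute:
  assumes "a \<in> carrier G" "b \<in> carrier G"
    and "a \<otimes> a = \<one>" "b \<otimes> b = \<one>" "(a \<otimes> b) \<otimes> (a \<otimes> b) = \<one>"
  shows "a \<otimes> b = b \<otimes> a"
proof -
  have "inv a = a" "inv b = b" "inv (a \<otimes> b) = a \<otimes> b"
    using assms by (auto intro: inv_equality)
  then show ?thesis
    using assms inv_mult_group[of a b] by simp
qed

text \<open>Supplies the index functions that \<open>subtuple_equiv\<close> quantifies over.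
  Positions in the sorted list start at 0, arguments of \<open>p\<close> at 1, hence the shift by
  one.\<close>

lemma strict_mono_on_enumeration:
  fixes S :: "nat set"
  assumes "finite S"
  obtains p where "strict_mono_on {1..card S} p" "S = p ` {1..card S}"
proof
  let ?p = "\<lambda>i. sorted_list_of_set S ! (i - 1)"
  show "strict_mono_on {1..card S} ?p"
    by (rule strict_mono_onI) (auto intro!: sorted_wrt_nth_less[OF strict_sorted_list_of_set] simp: assms)
  have "S = set (sorted_list_of_set S)" using assms by simp
  also have "\<dots> = (!) (sorted_list_of_set S) ` {..<card S}"
    using assms by (auto simp: set_conv_nth)
  also have "{..<card S} = (\<lambda>i. i - 1) ` {1..card S}"
    by (force simp: image_iff intro: bexI[of _ "Suc _"])
  finally show "S = ?p ` {1..card S}" by (simp add: image_image)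
qed

lemma (in group) commute_mult:
  assumes "x \<in> carrier G" "u \<in> carrier G" "v \<in> carrier G" "x \<otimes> u = u \<otimes> x" "x \<otimes> v = v \<otimes> x"
  shows "x \<otimes> (u \<otimes> v) = (u \<otimes> v) \<otimes> x"
proof -
  have "x \<otimes> (u \<otimes> v) = u \<otimes> (x \<otimes> v)" using assms by (metis m_assoc)
  then show ?thesis using assms by (simp add: m_assoc)
qed

section \<open>Right actions: from triples to all entries\<close>

locale right_action = group G for G :: "('a, 'c) monoid_scheme" (structure) +
  fixes \<Omega> :: "'b set" and act :: "'b \<Rightarrow> 'a \<Rightarrow> 'b"
  assumes act_closed: "\<lbrakk>x \<in> \<Omega>; g \<in> carrier G\<rbrakk> \<Longrightarrow> act x g \<in> \<Omega>"
    and act_one: "x \<in> \<Omega> \<Longrightarrow> act x \<one> = x"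
    and act_mult: "\<lbrakk>x \<in> \<Omega>; g \<in> carrier G; h \<in> carrier G\<rbrakk> \<Longrightarrow> act (act x g) h = act x (g \<otimes> h)"
begin

definition stab :: "'b \<Rightarrow> 'a set" where
  "stab x = {g \<in> carrier G. act x g = x}"

lemma stab_carrier: "g \<in> stab x \<Longrightarrow> g \<in> carrier G"
  by (simp add: stab_def)

lemma stab_mult: "\<lbrakk>x \<in> \<Omega>; g \<in> stab x; h \<in> stab x\<rbrakk> \<Longrightarrow> g \<otimes> h \<in> stab x"
  by (auto simp: stab_def simp flip: act_mult)

lemma one_in_stab: "x \<in> \<Omega> \<Longrightarrow> \<one> \<in> stab x"
  by (simp add: stab_def act_one)

lemma act_inv:
  assumes "x \<in> \<Omega>" "g \<in> carrier G" "act x g = y"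
  shows "act y (inv g) = x"
  using assms(1,2) by (simp add: act_mult act_one flip: assms(3))

lemma transporter_stab:
  assumes "x \<in> \<Omega>" "g \<in> carrier G" "h \<in> carrier G" "act x g = act x h"
  shows "g \<otimes> inv h \<in> stab x"
proof -
  have "act x (g \<otimes> inv h) = act (act x h) (inv h)"
    using assms by (simp flip: act_mult)
  then show ?thesis
    using assms act_inv by (simp add: stab_def)
qed

text \<open>The hypotheses isolate what the argument takes from dihedral stabilisers. The value
  \<open>z x\<close> is constrained only when \<open>stab x\<close> contains two distinct commuting
  involutions. Indices in \<open>triples\<close> may repeat, so single entries and pairs are covered
  too.\<close>

lemma simultaneous_transporter:
  assumes stab_inj: "inj_on stab \<Omega>"
    and exp2: "\<And>x y g. \<lbrakk>x \<in> \<Omega>; y \<in> \<Omega>; x \<noteq> y; g \<in> stab x; g \<in> stab y\<rbrakk> \<Longrightarrow> g \<otimes> g = \<one>"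
    and central: "\<And>x t b. \<lbrakk>x \<in> \<Omega>; t \<in> stab x; b \<in> stab x; t \<noteq> b; t \<noteq> \<one>; b \<noteq> \<one>;
        t \<otimes> t = \<one>; b \<otimes> b = \<one>; t \<otimes> b = b \<otimes> t\<rbrakk> \<Longrightarrow>
        z x \<in> {t, b, t \<otimes> b} \<and> stab x = {g \<in> carrier G. g \<otimes> z x = z x \<otimes> g}"
    and I: "I \<in> A \<rightarrow> \<Omega>"
    and triples: "\<And>i j k. \<lbrakk>i \<in> A; j \<in> A; k \<in> A\<rbrakk> \<Longrightarrow>
        \<exists>g\<in>carrier G. act (I i) g = J i \<and> act (I j) g = J j \<and> act (I k) g = J k"
  shows "\<exists>g\<in>carrier G. \<forall>i\<in>A. act (I i) g = J i"
proof (cases "\<exists>i\<in>A. \<exists>j\<in>A. I i \<noteq> I j")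
  \<comment> \<open>All entries of \<open>I\<close> coincide, and comparing pairs shows that those
    of \<open>J\<close> do too.\<close>
  case False
  show ?thesis
  proof (cases "A = {}")
    case True
    then show ?thesis by auto
  next
    case False
    then obtain i where i: "i \<in> A" by auto
    from triples[OF i i i] obtain g where g: "g \<in> carrier G" "act (I i) g = J i" by auto
    have "act (I j) g = J j" if j: "j \<in> A" for j
    proof -
      have "I j = I i" using \<open>\<not> (\<exists>i\<in>A. \<exists>j\<in>A. I i \<noteq> I j)\<close> i j by metis
      then show ?thesis using triples[OF i i j] g by auto
    qed
    then show ?thesis using g by auto
  qed
next
  case True
  have I\<Omega>: "I i \<in> \<Omega>" if "i \<in> A" for i using I that by auto
  \<comment> \<open>Take \<open>g\<close> carrying \<open>I\<close> to \<open>J\<close> at three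
    given indices and translate \<open>J\<close> by \<open>inv g\<close>. The result
    \<open>J'\<close> agrees with \<open>I\<close> there and is still equivalent to \<open>I\<close>
    on triples. From here on the goal is \<open>J' l = I l\<close> for all \<open>l\<close>, since
    \<open>g\<close> carries \<open>J'\<close> back to \<open>J\<close>.\<close>
  have align: "\<exists>g\<in>carrier G. \<exists>J'. (\<forall>i\<in>A. J i = act (J' i) g) \<and> J' i = I i \<and> J' j = I j \<and> J' k = I k \<and>
      (\<forall>i\<in>A. J' i \<in> \<Omega>) \<and>
      (\<forall>p\<in>A. \<forall>q\<in>A. \<forall>r\<in>A. \<exists>h\<in>carrier G. act (I p) h = J' p \<and> act (I q) h = J' q \<and> act (I r) h = J' r)"
    if ijk: "i \<in> A" "j \<in> A" "k \<in> A" for i j k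
  proof -
    obtain g where g: "g \<in> carrier G" "act (I i) g = J i" "act (I j) g = J j" "act (I k) g = J k"
      using triples[OF ijk] by auto
    have J\<Omega>: "J l \<in> \<Omega>" if "l \<in> A" for l
      using triples[OF that that that] act_closed[OF I\<Omega>[OF that]] by metis
    define J' where "J' l = act (J l) (inv g)" for l
    have "J l = act (J' l) g" if "l \<in> A" for l
      using act_inv[OF J\<Omega>[OF that], of "inv g" "J' l"] g by (simp add: J'_def)
    moreover have "J' i = I i" "J' j = I j" "J' k = I k"
      using act_inv[OF I\<Omega> g(1)] g ijk by (auto simp: J'_def)
    moreover have "J' l \<in> \<Omega>" if "l \<in> A" for l
      using J\<Omega>[OF that] act_closed g by (simp add: J'_def)
    moreover have "\<exists>h\<in>carrier G. act (I p) h = J' p \<and> act (I q) h = J' q \<and> act (I r) h = J' r"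
      if pqr: "p \<in> A" "q \<in> A" "r \<in> A" for p q r
    proof -
      obtain h where h: "h \<in> carrier G" "act (I p) h = J p" "act (I q) h = J q" "act (I r) h = J r"
        using triples[OF pqr] by auto
      have "act (I l) (h \<otimes> inv g) = act (act (I l) h) (inv g)" if "l \<in> A" for l
        using act_mult[OF I\<Omega>[OF that]] h g by simp
      then show ?thesis using h g pqr by (intro bexI[of _ "h \<otimes> inv g"]) (auto simp: J'_def)
    qed
    ultimately show ?thesis using g(1) by (intro bexI[of _ g] exI[of _ J']) auto
  qed
  \<comment> \<open>The element \<open>t\<close> may be \<open>\<one>\<close>, so trivial two-point
    stabilisers fall under the first case.\<close>
  show ?thesis
  proof (cases "\<exists>i\<in>A. \<exists>j\<in>A. \<exists>t. I i \<noteq> I j \<and> t \<in> stab (I i) \<inter> stab (I j) \<and> stab (I i) \<inter> stab (I j) \<subseteq> {\<one>, t}")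
    case True
    then obtain i j t where ij: "i \<in> A" "j \<in> A" "I i \<noteq> I j"
      and t: "t \<in> stab (I i)" "t \<in> stab (I j)" and sub: "stab (I i) \<inter> stab (I j) \<subseteq> {\<one>, t}"
      by auto
    show ?thesis
    proof (cases "\<forall>k\<in>A. t \<in> stab (I k)")
      case True
      obtain g J' where g: "g \<in> carrier G" "\<forall>i\<in>A. J i = act (J' i) g" "J' i = I i" "J' j = I j"
        and tr: "\<forall>p\<in>A. \<forall>q\<in>A. \<forall>r\<in>A. \<exists>h\<in>carrier G. act (I p) h = J' p \<and> act (I q) h = J' q \<and> act (I r) h = J' r"
        using align[OF ij(1,2,2)] by blast
      \<comment> \<open>An element carrying \<open>I\<close> to \<open>J'\<close> at
        \<open>i\<close>, \<open>j\<close> and \<open>l\<close> fixes \<open>I i\<close> and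
        \<open>I j\<close>, so it is \<open>\<one>\<close> or \<open>t\<close>, and both fix
        \<open>I l\<close>.\<close>
      have "J' l = I l" if l: "l \<in> A" for l
      proof -
        obtain h where h: "h \<in> carrier G" "act (I i) h = I i" "act (I j) h = I j" "act (I l) h = J' l"
          using tr ij l g by metis
        then have "h \<in> {\<one>, t}" using sub by (auto simp: stab_def)
        then show ?thesis
          using True l h(4) act_one[OF I\<Omega>[OF l]] by (auto simp: stab_def)
      qed
      then show ?thesis using g by auto
    next
      case False
      then obtain k where k: "k \<in> A" "t \<notin> stab (I k)" by auto
      obtain g J' where g: "g \<in> carrier G" "\<forall>i\<in>A. J i = act (J' i) g"
        "J' i = I i" "J' j = I j" "J' k = I k"
        and tr: "\<forall>p\<in>A. \<forall>q\<in>A. \<forall>r\<in>A. \<exists>h\<in>carrier G. act (I p) h = J' p \<and> act (I q) h = J' q \<and> act (I r) h = J' r"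
        using align[OF ij(1,2) k(1)] by blast
      have "J' l = I l" if l: "l \<in> A" for l
      proof (rule ccontr)
        assume ne: "J' l \<noteq> I l"
        \<comment> \<open>Each of \<open>a\<close>, \<open>b\<close>, \<open>c\<close> comes from
          the triple formed by \<open>l\<close> and two of the aligned indices. All three move
          \<open>I l\<close> to \<open>J' l\<close>, so none is trivial.\<close>
        obtain a where a: "a \<in> carrier G" "act (I i) a = I i" "act (I j) a = I j" "act (I l) a = J' l"
          using tr ij l g by metis
        obtain b where b: "b \<in> carrier G" "act (I i) b = I i" "act (I k) b = I k" "act (I l) b = J' l"
          using tr ij k l g by metis
        obtain c where c: "c \<in> carrier G" "act (I j) c = I j" "act (I k) c = I k" "act (I l) c = J' l"
          using tr ij k l g by metis
        have n1: "a \<noteq> \<one>" "b \<noteq> \<one>" "c \<noteq> \<one>"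
          using a b c ne act_one[OF I\<Omega>[OF l]] by auto
        have at: "a = t" using a n1 sub by (auto simp: stab_def)
        have Ik: "I k \<noteq> I i" "I k \<noteq> I j" using k t by auto
        have Il: "I l \<noteq> I i" "I l \<noteq> I j" "I l \<noteq> I k"
          using a b ne by auto
        have st: "a \<in> stab (I i)" "a \<in> stab (I j)" "a \<notin> stab (I k)" "b \<in> stab (I i)" "b \<in> stab (I k)"
          "c \<in> stab (I j)" "c \<in> stab (I k)"
          using a b c k at by (auto simp: stab_def)
        have sq: "a \<otimes> a = \<one>" "b \<otimes> b = \<one>" "c \<otimes> c = \<one>"
          using exp2[OF I\<Omega> I\<Omega>] ij k Ik st by metis+
        then have inv: "inv a = a" "inv b = b" "inv c = c"
          using a b c by (auto intro: inv_equality)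
        \<comment> \<open>Both \<open>u\<close> and \<open>v\<close> carry \<open>I l\<close> to
          \<open>J' l\<close>, so \<open>u \<otimes> inv v = u \<otimes> v\<close> fixes
          \<open>I l\<close> as well as \<open>I w\<close>. By \<open>exp2\<close> its square is
          trivial, which forces the involutions to commute.\<close>
        have com: "u \<otimes> v = v \<otimes> u"
          if "w \<in> A" "I w \<noteq> I l" "u \<in> stab (I w)" "v \<in> stab (I w)" "act (I l) u = J' l" "act (I l) v = J' l"
            "u \<otimes> u = \<one>" "v \<otimes> v = \<one>" for u v w
        proof (rule involutions_commute)
          have c: "u \<in> carrier G" "v \<in> carrier G" using that by (auto simp: stab_def)
          have "inv v = v" using that c by (auto intro: inv_equality)
          then have "u \<otimes> v \<in> stab (I l)"
            using transporter_stab[OF I\<Omega>[OF l] c] that by simp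
          then show "u \<otimes> v \<otimes> (u \<otimes> v) = \<one>"
            using exp2[OF I\<Omega>[OF \<open>w \<in> A\<close>] I\<Omega>[OF l]] that stab_mult[OF I\<Omega>[OF \<open>w \<in> A\<close>]] by blast
        qed (use that stab_carrier in auto)
        have ab: "a \<otimes> b = b \<otimes> a" using com[of i a b] ij Il st a b sq by metis
        have ac: "a \<otimes> c = c \<otimes> a" using com[of j a c] ij Il st a c sq by metis
        have bc: "b \<otimes> c = c \<otimes> b" using com[of k b c] k Il st b c sq by metis
        have ne': "a \<noteq> b" "a \<noteq> c" using st by auto
        have zi: "z (I i) \<in> {a, b, a \<otimes> b}" "stab (I i) = {g \<in> carrier G. g \<otimes> z (I i) = z (I i) \<otimes> g}"
          using central[OF I\<Omega>[OF ij(1)] st(1,4) ne'(1) n1(1,2) sq(1,2) ab] by auto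
        have zj: "z (I j) \<in> {a, c, a \<otimes> c}" "stab (I j) = {g \<in> carrier G. g \<otimes> z (I j) = z (I j) \<otimes> g}"
          using central[OF I\<Omega>[OF ij(2)] st(2,6) ne'(2) n1(1,3) sq(1,3) ac] by auto
        have zc: "z (I i) \<in> carrier G" "z (I j) \<in> carrier G" using zi(1) zj(1) a(1) b(1) c(1) by auto
        \<comment> \<open>Since \<open>a\<close>, \<open>b\<close>, \<open>c\<close> commute
          pairwise, so do all products of them, in particular the two candidates for central
          involutions.\<close>
        have comm: "x \<otimes> y = y \<otimes> x" if "x \<in> {a, b, a \<otimes> b}" "y \<in> {a, c, a \<otimes> c}" for x y
        proof -
          have "w \<otimes> (a \<otimes> c) = (a \<otimes> c) \<otimes> w" if "w \<in> {a, b}" for w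
            using that ab ac bc a(1) b(1) c(1) by (auto intro!: commute_mult)
          then have y: "a \<otimes> y = y \<otimes> a" "b \<otimes> y = y \<otimes> b" "y \<in> carrier G"
            using \<open>y \<in> {a, c, a \<otimes> c}\<close> ab ac bc a(1) c(1) by auto
          then have "y \<otimes> (a \<otimes> b) = (a \<otimes> b) \<otimes> y"
            using a(1) b(1) by (intro commute_mult) auto
          then show ?thesis using that(1) y by auto
        qed
        have zz: "z (I i) \<otimes> z (I j) = z (I j) \<otimes> z (I i)"
          using comm zi(1) zj(1) by blast
        \<comment> \<open>Stabilisers are centralisers of their central involutions, so two
          commuting central involutions lie in both stabilisers. The intersection leaves only
          \<open>a\<close> as a non-trivial value for both.\<close>
        have "z (I i) \<in> stab (I i) \<inter> stab (I j)" "z (I j) \<in> stab (I i) \<inter> stab (I j)"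
          using zi zj zc zz by auto
        then have z: "z (I i) \<in> {\<one>, a}" "z (I j) \<in> {\<one>, a}" using sub at by auto
        have "a \<otimes> b \<noteq> \<one>" "a \<otimes> c \<noteq> \<one>"
          using ne' inv a(1) b(1) c(1) by (metis inv_equality inv_inv)+
        then have "z (I i) \<noteq> \<one>" "z (I j) \<noteq> \<one>" using zi(1) zj(1) n1 by auto
        then have "z (I i) = z (I j)" using z by auto
        then have "stab (I i) = stab (I j)" using zi zj by metis
        then show False using stab_inj ij I\<Omega> by (auto dest: inj_onD)
      qed
      then show ?thesis using g by auto
    qed
  next
    case False
    \<comment> \<open>The negated case condition yields \<open>t\<close> when applied to
      \<open>\<one>\<close>, and then \<open>b\<close> when applied to \<open>t\<close>.\<close>
    have big: "\<exists>t\<in>stab (I i) \<inter> stab (I j). \<exists>b\<in>stab (I i) \<inter> stab (I j). t \<noteq> \<one> \<and> b \<noteq> \<one> \<and> t \<noteq> b"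
      if ij: "i \<in> A" "j \<in> A" "I i \<noteq> I j" for i j
    proof -
      have "\<one> \<in> stab (I i) \<inter> stab (I j)" using one_in_stab I\<Omega> ij by auto
      then obtain t where t: "t \<in> stab (I i) \<inter> stab (I j)" "t \<noteq> \<one>" using False ij by blast
      then obtain b where "b \<in> stab (I i) \<inter> stab (I j)" "b \<noteq> \<one>" "b \<noteq> t" using False ij by blast
      then show ?thesis using t by metis
    qed
    have sq: "g \<otimes> g = \<one>" if "i \<in> A" "j \<in> A" "I i \<noteq> I j" "g \<in> stab (I i) \<inter> stab (I j)" for g i j
      using exp2[OF I\<Omega> I\<Omega>] that by blast
    have com: "u \<otimes> v = v \<otimes> u"
      if "i \<in> A" "j \<in> A" "I i \<noteq> I j" "u \<in> stab (I i) \<inter> stab (I j)" "v \<in> stab (I i) \<inter> stab (I j)" for u v i j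
      using that sq[OF that(1-3)] stab_mult I\<Omega> stab_carrier
      by (intro involutions_commute) auto
    \<comment> \<open>The central involution at \<open>I i\<close> is one of \<open>t\<close>,
      \<open>b\<close>, \<open>t \<otimes> b\<close>, all of which fix \<open>I j\<close>. As
      \<open>j\<close> varies, it therefore fixes every entry of \<open>I\<close>.\<close>
    have zs: "z (I i) \<in> stab (I i) \<inter> stab (I j)" "z (I i) \<noteq> \<one>"
      "stab (I i) = {g \<in> carrier G. g \<otimes> z (I i) = z (I i) \<otimes> g}"
      if ij: "i \<in> A" "j \<in> A" "I i \<noteq> I j" for i j
    proof -
      obtain t b where tb: "t \<in> stab (I i) \<inter> stab (I j)" "b \<in> stab (I i) \<inter> stab (I j)"
        "t \<noteq> \<one>" "b \<noteq> \<one>" "t \<noteq> b" using big[OF ij] by auto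
      have z: "z (I i) \<in> {t, b, t \<otimes> b} \<and> stab (I i) = {g \<in> carrier G. g \<otimes> z (I i) = z (I i) \<otimes> g}"
        by (rule central) (use I\<Omega>[OF ij(1)] tb sq[OF ij] com[OF ij] in auto)
      show "stab (I i) = {g \<in> carrier G. g \<otimes> z (I i) = z (I i) \<otimes> g}" using z by (rule conjunct2)
      show "z (I i) \<in> stab (I i) \<inter> stab (I j)" using conjunct1[OF z] tb stab_mult I\<Omega> ij by auto
      have "t \<otimes> b \<noteq> \<one>" using tb sq[OF ij tb(1)] stab_carrier
        by (metis IntD1 inv_equality inv_inv)
      then show "z (I i) \<noteq> \<one>" using conjunct1[OF z] tb by auto
    qed
    obtain i j where ij: "i \<in> A" "j \<in> A" "I i \<noteq> I j" using True by auto
    obtain g J' where g: "g \<in> carrier G" "\<forall>i\<in>A. J i = act (J' i) g" "J' i = I i" "J' j = I j"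
      and tr: "\<forall>p\<in>A. \<forall>q\<in>A. \<forall>r\<in>A. \<exists>h\<in>carrier G. act (I p) h = J' p \<and> act (I q) h = J' q \<and> act (I r) h = J' r"
      using align[OF ij(1,2,2)] by blast
    have "J' l = I l" if l: "l \<in> A" for l
    proof -
      obtain h where h: "h \<in> carrier G" "act (I i) h = I i" "act (I j) h = I j" "act (I l) h = J' l"
        using tr ij l g by metis
      then have hs: "h \<in> stab (I i) \<inter> stab (I j)" by (auto simp: stab_def)
      note zi = zs[OF ij] and zj = zs[OF ij(2,1) ij(3)[symmetric]]
      have zne: "z (I i) \<noteq> z (I j)"
        using zi(3) zj(3) stab_inj I\<Omega> ij by (metis inj_onD)
      \<comment> \<open>Otherwise \<open>central\<close> applies at \<open>I i\<close> to the
        commuting involutions \<open>h\<close> and \<open>z (I j)\<close>. The only value left for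
        \<open>z (I i)\<close> is \<open>h \<otimes> z (I j)\<close>, which makes \<open>h\<close>
        the product of the two central involutions.\<close>
      have hz: "h \<in> {\<one>, z (I i), z (I j), z (I i) \<otimes> z (I j)}"
      proof (rule ccontr)
        assume hn: "h \<notin> {\<one>, z (I i), z (I j), z (I i) \<otimes> z (I j)}"
        have "z (I i) \<in> {h, z (I j), h \<otimes> z (I j)}"
          by (rule central[THEN conjunct1])
            (use I\<Omega>[OF ij(1)] hs zj(1,2) hn sq[OF ij] com[OF ij] in auto)
        then have "z (I i) = h \<otimes> z (I j)" using hn zne by auto
        then have "z (I i) \<otimes> z (I j) = h"
          using sq[OF ij, of "z (I j)"] zj(1) h(1) stab_carrier
          by (metis Int_iff m_assoc r_one)
        then show False using hn by auto
      qed
      have "h \<in> stab (I l)"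
      proof (cases "I l = I i \<or> I l = I j")
        case True
        then show ?thesis using hs by auto
      next
        case False
        then have "z (I i) \<in> stab (I l)" "z (I j) \<in> stab (I l)"
          using zs(1)[OF ij(1) l] zs(1)[OF ij(2) l] by auto
        then show ?thesis using hz one_in_stab stab_mult I\<Omega>[OF l] by auto
      qed
      then show ?thesis using h by (simp add: stab_def)
    qed
    then show ?thesis using g by auto
  qed
qed

lemma relational_complexity_le_3:
  assumes "\<And>(A :: nat set) I J. \<lbrakk>I \<in> A \<rightarrow> \<Omega>; \<And>i j k. \<lbrakk>i \<in> A; j \<in> A; k \<in> A\<rbrakk> \<Longrightarrow>
        \<exists>g\<in>carrier G. act (I i) g = J i \<and> act (I j) g = J j \<and> act (I k) g = J k\<rbrakk>
      \<Longrightarrow> \<exists>g\<in>carrier G. \<forall>i\<in>A. act (I i) g = J i"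
  shows "relational_complexity G act \<Omega> \<le> 3"
  unfolding relational_complexity_def
proof (rule Least_le, intro conjI allI impI ballI)
  show "2 \<le> (3::nat)" by simp
next
  fix m :: nat and I J
  assume m: "3 \<le> m" and I: "I \<in> tuples \<Omega> m" and eq: "subtuple_equiv G act m 3 I J"
  have "\<exists>g\<in>carrier G. \<forall>i\<in>{1..m}. act (I i) g = J i"
  proof (rule assms)
    show "I \<in> {1..m} \<rightarrow> \<Omega>" using I by (auto simp: tuples_def)
    fix i j k assume "i \<in> {1..m}" "j \<in> {1..m}" "k \<in> {1..m}"
    then have "{i, j, k} \<subseteq> {1..m}" "card {i, j, k} \<le> 3" by (auto simp: card_insert_if)
    \<comment> \<open>The three indices may coincide, while \<open>subtuple_equiv\<close> ranges
      over three distinct ones. The bound \<open>3 \<le> m\<close> leaves room to enlarge the set to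
      exactly three indices.\<close>
    then obtain S where S: "{i, j, k} \<subseteq> S" "S \<subseteq> {1..m}" "card S = 3"
      using m by (metis card_atLeastAtMost diff_Suc_1 finite_atLeastAtMost exists_subset_between)
    then have fin: "finite S" using finite_subset by blast
    obtain p :: "nat \<Rightarrow> nat" where p: "strict_mono_on {1..3} p" "S = p ` {1..3}"
      using strict_mono_on_enumeration[OF fin] S(3) by metis
    then have "p \<in> {1..3} \<rightarrow> {1..m}" using S(2) by auto
    with p(1) obtain g where "g \<in> carrier G" "\<forall>i\<in>{1..3}. act (I (p i)) g = J (p i)"
      using eq by (auto simp: subtuple_equiv_def)
    then show "\<exists>g\<in>carrier G. act (I i) g = J i \<and> act (I j) g = J j \<and> act (I k) g = J k"
      using S(1) p(2) by (intro bexI[of _ g]) auto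
qed
  then show "subtuple_equiv G act m m I J"
    by (fastforce simp: subtuple_equiv_def)
qed

end

section \<open>Rotations and reflections of a dihedral subgroup\<close>

locale rotations = group G + subgroup K G for G :: "('a, 'c) monoid_scheme" (structure) and K +
  fixes C :: "'a set"
  assumes rotations_subgroup: "subgroup C G" and rotations_subset: "C \<subseteq> K"
    and rotations_comm: "\<lbrakk>c \<in> C; d \<in> C\<rbrakk> \<Longrightarrow> c \<otimes> d = d \<otimes> c"
    and reflection_sq: "\<lbrakk>h \<in> K; h \<notin> C\<rbrakk> \<Longrightarrow> h \<otimes> h = \<one>"
    and reflection_mult: "\<lbrakk>h \<in> K; h \<notin> C; k \<in> K; k \<notin> C\<rbrakk> \<Longrightarrow> h \<otimes> k \<in> C"
    and rotation_involution_unique: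
      "\<lbrakk>c \<in> C; d \<in> C; c \<noteq> \<one>; d \<noteq> \<one>; c \<otimes> c = \<one>; d \<otimes> d = \<one>\<rbrakk> \<Longrightarrow> c = d"

text \<open>Pulls the rotations back along an isomorphism with \<open>dihedral_group n\<close>.
  Coordinates are used only here; of the cyclicity of \<open>C\<close>, the locale keeps
  commutativity and the uniqueness of an involution.\<close>

lemma (in group) is_dihedral_rotations:
  assumes K: "subgroup K G" and dih: "is_dihedral (G\<lparr>carrier := K\<rparr>)"
  shows "\<exists>C. rotations G K C"
proof -
  interpret K: subgroup K G by fact
  obtain n f where n: "n \<ge> 1" and f: "f \<in> iso (G\<lparr>carrier := K\<rparr>) (dihedral_group n)"
    using dih by (auto simp: is_dihedral_def is_iso_def)
  interpret D: group "dihedral_group n" using n by (rule group_dihedral_group)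
  interpret f: group_hom "G\<lparr>carrier := K\<rparr>" "dihedral_group n" f
    using f K by (simp add: group_hom_def group_hom_axioms_def iso_def subgroup_imp_group)
  have mult: "f (x \<otimes> y) = f x \<otimes>\<^bsub>dihedral_group n\<^esub> f y" if "x \<in> K" "y \<in> K" for x y
    using f.hom_mult that by simp
  have one: "f \<one> = (0, False)" using f.hom_one by (simp add: dihedral_group_def)
  have inj: "x = y" if "f x = f y" "x \<in> K" "y \<in> K" for x y
    using f that by (auto simp: iso_def bij_betw_def dest: inj_onD)
  have fst: "fst (f x) \<in> {0..<int n}" if "x \<in> K" for x
    using f.hom_closed[of x] that by (auto simp: dihedral_group_def)
  have dmult: "(i, d) \<otimes>\<^bsub>dihedral_group n\<^esub> (j, e) = ((if d then i - j else i + j) mod int n, d \<noteq> e)" for i j d e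
    by (simp add: dihedral_group_def)
  define C where "C = {h \<in> K. \<not> snd (f h)}"
  have fC: "\<exists>i. f c = (i, False) \<and> 0 \<le> i \<and> i < int n" if "c \<in> C" for c
    using that fst[of c] by (cases "f c") (auto simp: C_def)
  have fR: "\<exists>i. f c = (i, True)" if "c \<in> K" "c \<notin> C" for c
    using that by (cases "f c") (auto simp: C_def)
  have sub: "subgroup C (G\<lparr>carrier := K\<rparr>)"
  proof (rule group.subgroupI)
    show "group (G\<lparr>carrier := K\<rparr>)" using K by (rule subgroup_imp_group)
    have "\<one> \<in> C" using one K.one_closed by (simp add: C_def)
    then show "C \<noteq> {}" by blast
    fix a assume a: "a \<in> C"
    then have aK: "a \<in> K" by (simp add: C_def)
    have "f (inv a \<otimes> a) = f (inv a) \<otimes>\<^bsub>dihedral_group n\<^esub> f a" by (rule mult) (use aK in auto)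
    then have "\<not> snd (f (inv a))"
      using fC[OF a] one aK by (cases "f (inv a)") (auto simp: dmult)
    then show "inv\<^bsub>G\<lparr>carrier := K\<rparr>\<^esub> a \<in> C"
      using aK unfolding m_inv_consistent[OF K aK] by (simp add: C_def)
    fix b assume b: "b \<in> C"
    then show "a \<otimes>\<^bsub>G\<lparr>carrier := K\<rparr>\<^esub> b \<in> C"
      using fC[OF a] fC[OF b] aK mult[of a b] by (auto simp: C_def dmult)
  qed (auto simp: C_def)
  have "rotations G K C"
  proof (intro rotations.intro rotations_axioms.intro)
    show "group G" ..
    show "subgroup K G" by (fact K)
    show "subgroup C G" using incl_subgroup[OF K sub] .
    show "C \<subseteq> K" by (auto simp: C_def)
    fix c d assume cd: "c \<in> C" "d \<in> C"
    then have K: "c \<in> K" "d \<in> K" by (auto simp: C_def)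
    obtain i j where ij: "f c = (i, False)" "0 \<le> i" "i < int n" "f d = (j, False)" "0 \<le> j" "j < int n"
      using fC[OF cd(1)] fC[OF cd(2)] by auto
    show "c \<otimes> d = d \<otimes> c"
      by (rule inj) (use K ij in \<open>auto simp: mult dmult add.commute\<close>)
    assume ne: "c \<noteq> \<one>" "d \<noteq> \<one>" and sq: "c \<otimes> c = \<one>" "d \<otimes> d = \<one>"
    have "i \<noteq> 0" "j \<noteq> 0" using ne inj[of c \<one>] inj[of d \<one>] K ij one by auto
    moreover have "(i + i) mod int n = 0" "(j + j) mod int n = 0"
      using sq mult[of c c] mult[of d d] K ij one by (auto simp: dmult)
    \<comment> \<open>The only multiple of \<open>int n\<close> strictly between 0 and
      \<open>2 * int n\<close> is \<open>int n\<close> itself.\<close>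
    moreover have "2 * l = int n" if "0 < l" "l < int n" "(l + l) mod int n = 0" for l
    proof -
      have "(l + l - int n) mod int n = 0" using that(3) by simp
      then show ?thesis using that(1,2) zmod_trivial_iff[of "l + l - int n" "int n"]
          zmod_trivial_iff[of "l + l" "int n"] that(3) by linarith
    qed
    ultimately have "i = j" using ij
      by (metis linorder_not_less mult_cancel_left order_antisym zero_neq_numeral)
    then show "c = d" using inj K ij by auto
  next
    fix h k assume h: "h \<in> K" "h \<notin> C"
    show "h \<otimes> h = \<one>"
      by (rule inj) (use h fR[OF h] in \<open>auto simp: mult dmult one\<close>)
    assume k: "k \<in> K" "k \<notin> C"
    show "h \<otimes> k \<in> C" using fR[OF h] fR[OF k] h k mult[of h k] by (auto simp: C_def dmult)
  qed
  then show ?thesis ..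
qed

text \<open>This is the normaliser of \<open>{c, inv c}\<close>: conjugation commutes with
  inversion, so a condition on \<open>c\<close> alone suffices.\<close>

lemma (in group) inv_conj_subgroup:
  assumes c: "c \<in> carrier G"
  shows "subgroup {g \<in> carrier G. g \<otimes> c \<otimes> inv g \<in> {c, inv c}} G"
proof (rule subgroupI)
  show "{g \<in> carrier G. g \<otimes> c \<otimes> inv g \<in> {c, inv c}} \<noteq> {}" using c by (auto intro!: exI[of _ \<one>])
  have conj_inv: "g \<otimes> inv c \<otimes> inv g = inv (g \<otimes> c \<otimes> inv g)" if "g \<in> carrier G" for g
    using c that by (simp add: inv_mult_group m_assoc)
  fix a assume a: "a \<in> {g \<in> carrier G. g \<otimes> c \<otimes> inv g \<in> {c, inv c}}"
  have aG: "a \<in> carrier G" using a by auto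
  have eq: "inv a \<otimes> (a \<otimes> x \<otimes> inv a) \<otimes> a = x" if "x \<in> carrier G" for x
    using aG that by (simp add: m_assoc) (simp flip: m_assoc)
  show "inv a \<in> {g \<in> carrier G. g \<otimes> c \<otimes> inv g \<in> {c, inv c}}"
    using a eq[of c] eq[of "inv c"] conj_inv[of a] c by auto
  fix b assume b: "b \<in> {g \<in> carrier G. g \<otimes> c \<otimes> inv g \<in> {c, inv c}}"
  have "(a \<otimes> b) \<otimes> c \<otimes> inv (a \<otimes> b) = a \<otimes> (b \<otimes> c \<otimes> inv b) \<otimes> inv a"
    using aG b c by (simp add: inv_mult_group m_assoc)
  then show "a \<otimes> b \<in> {g \<in> carrier G. g \<otimes> c \<otimes> inv g \<in> {c, inv c}}"
    using a b c conj_inv[of a] by auto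
qed auto

section \<open>Core-free maximal dihedral subgroups\<close>

locale core_free_dihedral = rotations +
  assumes maximal: "maximal_subgroup K G"
    and core_free: "\<lbrakk>N \<lhd> G; N \<subseteq> K\<rbrakk> \<Longrightarrow> N = {\<one>}"
begin

lemma rotations_carrier: "c \<in> C \<Longrightarrow> c \<in> carrier G"
  using rotations_subset subset by auto

text \<open>Rotations commute. For \<open>h\<close> outside \<open>C\<close>, the product
  \<open>h \<otimes> c\<close> is again outside \<open>C\<close>, and its trivial square says that
  \<open>h\<close> inverts \<open>c\<close>.\<close>

lemma conj_rotation:
  assumes h: "h \<in> K" and c: "c \<in> C"
  shows "h \<otimes> c \<otimes> inv h \<in> {c, inv c}"
proof (cases "h \<in> C")
  case True
  then have "h \<otimes> c \<otimes> inv h = c"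
    using c rotations_comm[OF True c] rotations_carrier by (simp add: m_assoc)
  then show ?thesis by simp
next
  case False
  note [simp] = rotations_carrier[OF c] mem_carrier[OF h]
  have hc: "h \<otimes> c \<in> K" "h \<otimes> c \<notin> C"
  proof -
    show "h \<otimes> c \<in> K" using h c rotations_subset by auto
    show "h \<otimes> c \<notin> C"
    proof
      assume "h \<otimes> c \<in> C"
      then have "h \<otimes> c \<otimes> inv c \<in> C"
        using c rotations_subgroup by (auto intro: subgroup.m_closed subgroup.m_inv_closed)
      then show False using False by (simp add: m_assoc)
    qed
  qed
  have "inv h = h" using reflection_sq[OF h False] by (auto intro: inv_equality)
  moreover
  have "(h \<otimes> c \<otimes> h) \<otimes> c = \<one>" using reflection_sq[OF hc] by (simp add: m_assoc)
  then have "h \<otimes> c \<otimes> h = inv c" by (intro inv_equality[symmetric]) auto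
  ultimately have "h \<otimes> c \<otimes> inv h = inv c" by simp
  then show ?thesis by simp
qed

text \<open>By maximality the normaliser of \<open>{c, inv c}\<close> is \<open>K\<close> or the
  whole group. In the latter case \<open>c\<close> would generate a non-trivial normal subgroup
  inside \<open>K\<close>.\<close>

lemma rotation_normaliser:
  assumes c: "c \<in> C" "c \<noteq> \<one>"
  shows "K = {g \<in> carrier G. g \<otimes> c \<otimes> inv g \<in> {c, inv c}}"
proof -
  let ?L = "{g \<in> carrier G. g \<otimes> c \<otimes> inv g \<in> {c, inv c}}"
  have cG: "c \<in> carrier G" using c rotations_carrier by simp
  have "K \<subseteq> ?L" using conj_rotation[OF _ c(1)] mem_carrier by auto
  then have "?L = K \<or> ?L = carrier G"
    using maximal inv_conj_subgroup[OF cG] by (auto simp: maximal_subgroup_def)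
  moreover have "?L \<noteq> carrier G"
  proof
    assume L: "?L = carrier G"
    have "generate G {c, inv c} \<lhd> G"
    proof (rule normal_generateI)
      fix h g assume h: "h \<in> {c, inv c}" and g: "g \<in> carrier G"
      have conj: "g \<otimes> c \<otimes> inv g \<in> {c, inv c}" using L g by blast
      moreover have "g \<otimes> inv c \<otimes> inv g = inv (g \<otimes> c \<otimes> inv g)"
        using cG g by (simp add: inv_mult_group m_assoc)
      ultimately show "g \<otimes> h \<otimes> inv g \<in> {c, inv c}" using h cG by auto
    qed (use cG in auto)
    moreover have "generate G {c, inv c} \<subseteq> K"
      using c rotations_subset by (intro generate_subgroup_incl subgroup_axioms) auto
    ultimately have "generate G {c, inv c} = {\<one>}" by (rule core_free)
    then show False using c generate.incl[of c "{c, inv c}" G] by auto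
  qed
  ultimately show ?thesis by auto
qed

lemma rotation_centraliser:
  assumes "c \<in> C" "c \<noteq> \<one>" "c \<otimes> c = \<one>"
  shows "K = {g \<in> carrier G. g \<otimes> c = c \<otimes> g}"
proof -
  have "inv c = c" "c \<in> carrier G" using assms rotations_carrier by (auto intro: inv_equality)
  then show ?thesis
    by (subst rotation_normaliser[OF assms(1,2)]) (auto simp: inv_solve_right')
qed

text \<open>One \<open>z\<close> has to serve all pairs \<open>t\<close>, \<open>b\<close>, because
  \<open>simultaneous_transporter\<close> expects a single element for each point.\<close>

lemma central_involution:
  "\<exists>z. \<forall>t\<in>K. \<forall>b\<in>K. t \<noteq> b \<and> t \<noteq> \<one> \<and> b \<noteq> \<one> \<and>
      t \<otimes> t = \<one> \<and> b \<otimes> b = \<one> \<and> t \<otimes> b = b \<otimes> t \<longrightarrow>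
      z \<in> {t, b, t \<otimes> b} \<and> K = {g \<in> carrier G. g \<otimes> z = z \<otimes> g}"
proof -
  \<comment> \<open>With an odd number of rotations there is no such \<open>z\<close>, but then no such \<open>t\<close> and \<open>b\<close> either.\<close>
  define z where "z = (SOME c. c \<in> C \<and> c \<noteq> \<one> \<and> c \<otimes> c = \<one>)"
  have z: "z = c \<and> K = {g \<in> carrier G. g \<otimes> c = c \<otimes> g}" if "c \<in> C" "c \<noteq> \<one>" "c \<otimes> c = \<one>" for c
  proof -
    have "z \<in> C \<and> z \<noteq> \<one> \<and> z \<otimes> z = \<one>" unfolding z_def by (rule someI[of _ c]) (use that in auto)
    then show ?thesis using that rotation_involution_unique[of z c] rotation_centraliser[OF that] by blast
  qed
  show ?thesis
  proof (intro exI[of _ z] ballI impI)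
    fix t b assume "t \<in> K" "b \<in> K" "t \<noteq> b \<and> t \<noteq> \<one> \<and> b \<noteq> \<one> \<and>
      t \<otimes> t = \<one> \<and> b \<otimes> b = \<one> \<and> t \<otimes> b = b \<otimes> t"
    then have tb: "t \<in> K" "b \<in> K" "t \<noteq> b" "t \<noteq> \<one>" "b \<noteq> \<one>" "t \<otimes> t = \<one>" "b \<otimes> b = \<one>" "t \<otimes> b = b \<otimes> t" by auto
    note [simp] = mem_carrier[OF tb(1)] mem_carrier[OF tb(2)]
    have "t \<otimes> b \<noteq> \<one>"
    proof
      assume "t \<otimes> b = \<one>"
      then have "inv b = t" "inv b = b" using tb by (auto intro: inv_equality)
      then show False using tb by simp
    qed
    moreover have "t \<otimes> b \<otimes> (t \<otimes> b) = \<one>"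
    proof -
      have "t \<otimes> b \<otimes> (t \<otimes> b) = t \<otimes> b \<otimes> (b \<otimes> t)" by (simp only: tb(8))
      also have "\<dots> = t \<otimes> (b \<otimes> b) \<otimes> t" by (simp add: m_assoc del: tb)
      finally show ?thesis using tb by simp
    qed
    \<comment> \<open>Two reflections multiply to a rotation, so one of the three involutions is the
      unique one in \<open>C\<close>.\<close>
    moreover have "t \<in> C \<or> b \<in> C \<or> t \<otimes> b \<in> C" using reflection_mult tb by blast
    ultimately show "z \<in> {t, b, t \<otimes> b} \<and> K = {g \<in> carrier G. g \<otimes> z = z \<otimes> g}"
      using z[of t] z[of b] z[of "t \<otimes> b"] tb by blast
  qed
qed

end

text \<open>An element with non-trivial square is a rotation in both subgroups, and
  \<open>rotation_normaliser\<close> then describes both by the same condition on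
  \<open>g\<close>.\<close>

lemma core_free_dihedral_inter:
  assumes "core_free_dihedral G K C" "core_free_dihedral G K' C'" "K \<noteq> K'"
    and g: "g \<in> K" "g \<in> K'"
  shows "g \<otimes>\<^bsub>G\<^esub> g = \<one>\<^bsub>G\<^esub>"
proof -
  interpret K: core_free_dihedral G K C by fact
  interpret K': core_free_dihedral G K' C' by fact
  show ?thesis
  proof (rule ccontr)
    assume "g \<otimes>\<^bsub>G\<^esub> g \<noteq> \<one>\<^bsub>G\<^esub>"
    then have "g \<in> C" "g \<in> C'" "g \<noteq> \<one>\<^bsub>G\<^esub>"
      using K.reflection_sq K'.reflection_sq g by auto
    then have "K = K'"
      using K.rotation_normaliser[of g] K'.rotation_normaliser[of g] by blast
    then show False using assms(3) by contradiction
  qed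
qed

section \<open>Conjugate subgroups, written as preimages: \<open>conj_vimage g L\<close> is the
  conjugate of \<open>L\<close> by \<open>g\<close>\<close>

definition (in group) conj_vimage :: "'a \<Rightarrow> 'a set \<Rightarrow> 'a set" where
  "conj_vimage g L = {u \<in> carrier G. g \<otimes> u \<otimes> inv g \<in> L}"

context group
begin

lemma conj_cancel:
  assumes "g \<in> carrier G" "u \<in> carrier G"
  shows "inv g \<otimes> (g \<otimes> u \<otimes> inv g) \<otimes> g = u" "g \<otimes> (inv g \<otimes> u \<otimes> g) \<otimes> inv g = u"
  using assms by (simp_all add: m_assoc) (simp_all flip: m_assoc)

lemma conj_mult:
  assumes "g \<in> carrier G" "u \<in> carrier G" "v \<in> carrier G"
  shows "g \<otimes> (u \<otimes> v) \<otimes> inv g = (g \<otimes> u \<otimes> inv g) \<otimes> (g \<otimes> v \<otimes> inv g)"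
proof -
  have "inv g \<otimes> (g \<otimes> (v \<otimes> inv g)) = v \<otimes> inv g"
    using assms by (simp flip: m_assoc)
  then show ?thesis using assms by (simp add: m_assoc)
qed

lemma conj_vimage_subgroup:
  assumes g: "g \<in> carrier G" and L: "subgroup L G"
  shows "subgroup (conj_vimage g L) G"
proof (rule subgroupI)
  interpret L: subgroup L G by fact
  have "\<one> \<in> conj_vimage g L" using g by (simp add: conj_vimage_def)
  then show "conj_vimage g L \<noteq> {}" by blast
  fix a assume a: "a \<in> conj_vimage g L"
  have "g \<otimes> inv a \<otimes> inv g = inv (g \<otimes> a \<otimes> inv g)"
    using a g by (simp add: conj_vimage_def inv_mult_group m_assoc)
  then show "inv a \<in> conj_vimage g L" using a by (simp add: conj_vimage_def)
  fix b assume "b \<in> conj_vimage g L"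
  then show "a \<otimes> b \<in> conj_vimage g L" using a g by (simp add: conj_vimage_def conj_mult)
qed (auto simp: conj_vimage_def)

lemma conj_vimage_inv:
  assumes "g \<in> carrier G" "L \<subseteq> carrier G"
  shows "conj_vimage g (conj_vimage (inv g) L) = L"
  using assms by (auto simp: conj_vimage_def conj_cancel)

text \<open>Conjugation preserves inclusions and is undone by \<open>conj_vimage (inv g)\<close>, so
  subgroups above the conjugate correspond to subgroups above \<open>H\<close>.\<close>

lemma conj_vimage_maximal:
  assumes g: "g \<in> carrier G" and H: "maximal_subgroup H G"
  shows "maximal_subgroup (conj_vimage g H) G"
proof -
  have H': "subgroup H G" "H \<noteq> carrier G" "H \<subseteq> carrier G"
    using H by (auto simp: maximal_subgroup_def subgroup.subset)
  have mono: "conj_vimage x L \<subseteq> conj_vimage x M" if "L \<subseteq> M" for x L M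
    using that by (auto simp: conj_vimage_def)
  have full: "conj_vimage g (carrier G) = carrier G"
    using g by (auto simp: conj_vimage_def)
  have unconj: "conj_vimage (inv g) (conj_vimage g L) = L" if "L \<subseteq> carrier G" for L
    using conj_vimage_inv[of "inv g" L] g that by simp
  have "conj_vimage g H \<noteq> carrier G"
    using unconj[OF H'(3)] unconj[of "carrier G"] full H'(2) by auto
  moreover have "L = conj_vimage g H \<or> L = carrier G"
    if L: "subgroup L G" "conj_vimage g H \<subseteq> L" for L
  proof -
    have "H \<subseteq> conj_vimage (inv g) L"
      using mono[OF L(2)] unconj[OF H'(3)] by blast
    then have "conj_vimage (inv g) L = H \<or> conj_vimage (inv g) L = carrier G"
      using H conj_vimage_subgroup[of "inv g" L] g L by (auto simp: maximal_subgroup_def)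
    then show ?thesis
      using conj_vimage_inv[OF g subgroup.subset[OF L(1)]] full by auto
  qed
  ultimately show ?thesis
    using conj_vimage_subgroup[OF g H'(1)] by (auto simp: maximal_subgroup_def)
qed

lemma conj_vimage_iso:
  assumes g: "g \<in> carrier G" and H: "H \<subseteq> carrier G"
  shows "G\<lparr>carrier := conj_vimage g H\<rparr> \<cong> G\<lparr>carrier := H\<rparr>"
proof -
  have "(\<lambda>u. g \<otimes> u \<otimes> inv g) \<in> iso (G\<lparr>carrier := conj_vimage g H\<rparr>) (G\<lparr>carrier := H\<rparr>)"
  proof (rule isoI)
    show "(\<lambda>u. g \<otimes> u \<otimes> inv g) \<in> hom (G\<lparr>carrier := conj_vimage g H\<rparr>) (G\<lparr>carrier := H\<rparr>)"
      using g by (auto simp: hom_def conj_vimage_def conj_mult)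
    show "bij_betw (\<lambda>u. g \<otimes> u \<otimes> inv g) (carrier (G\<lparr>carrier := conj_vimage g H\<rparr>)) (carrier (G\<lparr>carrier := H\<rparr>))"
      by (rule bij_betw_byWitness[where f' = "\<lambda>u. inv g \<otimes> u \<otimes> g"])
        (use g H in \<open>auto simp: conj_vimage_def conj_cancel subset_iff\<close>)
  qed
  then show ?thesis by (rule is_isoI)
qed

text \<open>Transfers the properties of \<open>H\<close> to all point stabilisers. A normal subgroup
  contained in a conjugate of \<open>H\<close> is contained in \<open>H\<close>.\<close>

lemma core_free_dihedral_conj:
  assumes g: "g \<in> carrier G" and H: "maximal_subgroup H G" and dih: "is_dihedral (G\<lparr>carrier := H\<rparr>)"
    and core_free: "\<And>N. \<lbrakk>N \<lhd> G; N \<subseteq> H\<rbrakk> \<Longrightarrow> N = {\<one>}"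
  shows "\<exists>C. core_free_dihedral G (conj_vimage g H) C"
proof -
  have HG: "H \<subseteq> carrier G" using H by (simp add: maximal_subgroup_def subgroup.subset)
  have max: "maximal_subgroup (conj_vimage g H) G" using g H by (rule conj_vimage_maximal)
  have "is_dihedral (G\<lparr>carrier := conj_vimage g H\<rparr>)"
    using dih iso_trans[OF conj_vimage_iso[OF g HG]] by (auto simp: is_dihedral_def)
  then obtain C where C: "rotations G (conj_vimage g H) C"
    using is_dihedral_rotations[of "conj_vimage g H"] max by (auto simp only: maximal_subgroup_def)
  have "N = {\<one>}" if N: "N \<lhd> G" "N \<subseteq> conj_vimage g H" for N
  proof (rule core_free[OF N(1)], rule subsetI)
    fix x assume x: "x \<in> N"
    then have xG: "x \<in> carrier G" using N(2) by (auto simp: conj_vimage_def)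
    have "inv g \<otimes> x \<otimes> g \<in> N" using N(1) g x by (simp add: normal.inv_op_closed1)
    then have "g \<otimes> (inv g \<otimes> x \<otimes> g) \<otimes> inv g \<in> H" using N(2) by (auto simp: conj_vimage_def)
    then show "x \<in> H" using conj_cancel g xG by simp
  qed
  then show ?thesis
    using C max by (auto simp: core_free_dihedral_def core_free_dihedral_axioms_def)
qed

section \<open>The action on right cosets\<close>

lemma right_action_rcosets:
  assumes "subgroup H G"
  shows "right_action G (rcosets H) (\<lambda>C g. C #> g)"
proof
  interpret H: subgroup H G by fact
  fix x g assume x: "x \<in> rcosets H"
  then have xG: "x \<subseteq> carrier G" by (rule H.rcosets_carrier[OF is_group])
  show "x #> \<one> = x" using xG by simp
  assume g: "g \<in> carrier G"
  show "x #> g \<in> rcosets H"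
    using x g by (auto simp: RCOSETS_def coset_mult_assoc H.subset)
  fix h assume "h \<in> carrier G"
  then show "x #> g #> h = x #> (g \<otimes> h)" using xG g by (simp add: coset_mult_assoc)
qed

lemma coset_stabiliser:
  assumes H: "subgroup H G" and g: "g \<in> carrier G"
  shows "{u \<in> carrier G. H #> g #> u = H #> g} = conj_vimage g H"
proof -
  have HG: "H \<subseteq> carrier G" using H by (rule subgroup.subset)
  have "H #> g #> u = H #> g \<longleftrightarrow> g \<otimes> u \<otimes> inv g \<in> H" if u: "u \<in> carrier G" for u
  proof -
    have "H #> g #> u = H #> g \<longleftrightarrow> H #> (g \<otimes> u) = H #> g"
      using coset_mult_assoc[OF HG g u] by simp
    also have "\<dots> \<longleftrightarrow> H #> (g \<otimes> u \<otimes> inv g) = H"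
      using coset_mult_inv1[OF _ _ g HG] coset_mult_inv2[OF _ _ g HG] g u by blast
    also have "\<dots> \<longleftrightarrow> g \<otimes> u \<otimes> inv g \<in> H"
    proof -
      have "g \<otimes> u \<otimes> inv g \<in> carrier G" using g u by simp
      then show ?thesis using coset_join1[OF _ _ H] coset_join2[OF _ H] by blast
    qed
    finally show ?thesis .
  qed
  then show ?thesis by (auto simp: conj_vimage_def)
qed

text \<open>The normaliser lies above \<open>H\<close>, so it is \<open>H\<close> or the whole
  group, and the latter would make \<open>H\<close> normal.\<close>

lemma maximal_self_normalising:
  assumes H: "maximal_subgroup H G" "\<not> H \<lhd> G" and g: "g \<in> carrier G" and eq: "conj_vimage g H = H"
  shows "g \<in> H"
proof -
  have sub: "subgroup H G" using H by (simp add: maximal_subgroup_def)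
  interpret H: subgroup H G by fact
  let ?N = "{x \<in> carrier G. conj_vimage x H = H}"
  have conj: "conj_vimage (x \<otimes> y) L = conj_vimage y (conj_vimage x L)"
    if "x \<in> carrier G" "y \<in> carrier G" for x y L
    using that by (auto simp: conj_vimage_def inv_mult_group m_assoc)
  have N: "subgroup ?N G"
  proof (rule subgroupI)
    have "conj_vimage \<one> H = H" using H.subset by (auto simp: conj_vimage_def)
    then show "?N \<noteq> {}" by blast
    fix a assume a: "a \<in> ?N"
    then have "conj_vimage (inv a) (conj_vimage a H) = H"
      using conj_vimage_inv[of "inv a" H] H.subset by simp
    then show "inv a \<in> ?N" using a by simp
    fix b assume "b \<in> ?N"
    then show "a \<otimes> b \<in> ?N" using a by (simp add: conj)
  qed auto
  have "conj_vimage x H = H" if x: "x \<in> H" for x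
  proof
    show "H \<subseteq> conj_vimage x H" using x by (auto simp: conj_vimage_def)
    show "conj_vimage x H \<subseteq> H"
    proof
      fix u assume u: "u \<in> conj_vimage x H"
      then have "inv x \<otimes> (x \<otimes> u \<otimes> inv x) \<otimes> x \<in> H"
        using x by (simp add: conj_vimage_def del: m_assoc)
      then show "u \<in> H" using x u by (simp add: conj_vimage_def conj_cancel)
    qed
  qed
  then have "H \<subseteq> ?N" by auto
  then have "?N = H \<or> ?N = carrier G" using H(1) N by (auto simp: maximal_subgroup_def)
  moreover have "?N \<noteq> carrier G"
  proof
    assume "?N = carrier G"
    then have "x \<otimes> h \<otimes> inv x \<in> H" if "x \<in> carrier G" "h \<in> H" for x h
      using that by (auto simp: conj_vimage_def)
    then show False using H(2) sub by (simp add: normal_inv_iff)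
  qed
  ultimately show ?thesis using g eq by blast
qed

lemma relational_complexity_rcosets_dihedral:
  assumes "maximal_subgroup H G" and "\<not> H \<lhd> G" and "is_dihedral (G\<lparr>carrier := H\<rparr>)"
    and "\<And>N. \<lbrakk>N \<lhd> G; N \<subseteq> H\<rbrakk> \<Longrightarrow> N = {\<one>}"
  shows "relational_complexity G (\<lambda>C g. C #> g) (rcosets H) \<le> 3"
proof -
  have H: "subgroup H G" "H \<noteq> carrier G" using assms(1) by (auto simp: maximal_subgroup_def)
  interpret H: subgroup H G by fact
  interpret right_action G "rcosets H" "\<lambda>C g. C #> g" using H(1) by (rule right_action_rcosets)
  have stab: "stab (H #> g) = conj_vimage g H" if "g \<in> carrier G" for g
    unfolding stab_def using coset_stabiliser[OF H(1) that] .
  have dihedral: "\<exists>C. core_free_dihedral G (stab x) C" if x: "x \<in> rcosets H" for x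
  proof -
    obtain g where g: "g \<in> carrier G" "x = H #> g" using x by (auto simp: RCOSETS_def)
    have "\<exists>C. core_free_dihedral G (conj_vimage g H) C"
      using g(1) assms(1,3,4) by (rule core_free_dihedral_conj)
    then show ?thesis using stab g by simp
  qed
  \<comment> \<open>If \<open>H #> g\<close> and \<open>H #> h\<close> have the same stabiliser,
    then \<open>g \<otimes> inv h\<close> normalises \<open>H\<close> and so lies in
    \<open>H\<close>.\<close>
  have inj: "inj_on stab (rcosets H)"
  proof (rule inj_onI)
    fix x y assume "x \<in> rcosets H" "y \<in> rcosets H" and eq: "stab x = stab y"
    then obtain g h where g: "g \<in> carrier G" "x = H #> g" and h: "h \<in> carrier G" "y = H #> h"
      by (auto simp: RCOSETS_def)
    have "conj_vimage (g \<otimes> inv h) H = conj_vimage (inv h) (conj_vimage g H)"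
      using g(1) h(1) by (auto simp: conj_vimage_def inv_mult_group m_assoc)
    also have "conj_vimage g H = conj_vimage h H" using eq stab g h by simp
    also have "conj_vimage (inv h) (conj_vimage h H) = H"
      using conj_vimage_inv[of "inv h" H] h(1) H.subset by simp
    finally have "g \<otimes> inv h \<in> H"
      using maximal_self_normalising[OF assms(1,2)] g(1) h(1) by simp
    then have "H #> (g \<otimes> inv h) = H" using coset_join2 H(1) g(1) h(1) by simp
    then show "x = y" using coset_mult_inv1 g h H.subset by simp
  qed
  have "\<exists>z. \<forall>t\<in>stab x. \<forall>b\<in>stab x. t \<noteq> b \<and> t \<noteq> \<one> \<and> b \<noteq> \<one> \<and>
      t \<otimes> t = \<one> \<and> b \<otimes> b = \<one> \<and> t \<otimes> b = b \<otimes> t \<longrightarrow>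
      z \<in> {t, b, t \<otimes> b} \<and> stab x = {g \<in> carrier G. g \<otimes> z = z \<otimes> g}" if "x \<in> rcosets H" for x
    using dihedral[OF that] core_free_dihedral.central_involution by blast
  then have "\<exists>z. \<forall>x\<in>rcosets H. \<forall>t\<in>stab x. \<forall>b\<in>stab x. t \<noteq> b \<and> t \<noteq> \<one> \<and> b \<noteq> \<one> \<and>
      t \<otimes> t = \<one> \<and> b \<otimes> b = \<one> \<and> t \<otimes> b = b \<otimes> t \<longrightarrow>
      z x \<in> {t, b, t \<otimes> b} \<and> stab x = {g \<in> carrier G. g \<otimes> z x = z x \<otimes> g}"
    by (intro bchoice) blast
  then obtain z where z: "\<forall>x\<in>rcosets H. \<forall>t\<in>stab x. \<forall>b\<in>stab x. t \<noteq> b \<and> t \<noteq> \<one> \<and> b \<noteq> \<one> \<and>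
      t \<otimes> t = \<one> \<and> b \<otimes> b = \<one> \<and> t \<otimes> b = b \<otimes> t \<longrightarrow>
      z x \<in> {t, b, t \<otimes> b} \<and> stab x = {g \<in> carrier G. g \<otimes> z x = z x \<otimes> g}"
    by (rule exE)
  have exp2: "g \<otimes> g = \<one>"
    if xy: "x \<in> rcosets H" "y \<in> rcosets H" "x \<noteq> y" "g \<in> stab x" "g \<in> stab y" for x y g
  proof -
    obtain C D where "core_free_dihedral G (stab x) C" "core_free_dihedral G (stab y) D"
      using dihedral xy by blast
    then show ?thesis
      by (rule core_free_dihedral_inter) (use xy inj in \<open>auto dest: inj_onD\<close>)
  qed
  show ?thesis
  proof (rule relational_complexity_le_3, rule simultaneous_transporter[OF inj exp2])
    fix x t b
    assume "x \<in> rcosets H" "t \<in> stab x" "b \<in> stab x" "t \<noteq> b" "t \<noteq> \<one>" "b \<noteq> \<one>"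
      "t \<otimes> t = \<one>" "b \<otimes> b = \<one>" "t \<otimes> b = b \<otimes> t"
    then show "z x \<in> {t, b, t \<otimes> b} \<and> stab x = {g \<in> carrier G. g \<otimes> z x = z x \<otimes> g}"
      using z by blast
  qed
qed

end

theorem theorem5p4p5:
  fixes G :: "('a, 'c) monoid_scheme" and H :: "'a set"
  assumes "group G" and "finite (carrier G)"
    and "simple_group G \<or>
         (\<forall>N. N \<lhd> G \<and> N \<noteq> carrier G \<and> N \<noteq> {\<one>\<^bsub>G\<^esub>} \<longrightarrow> maximal_subgroup N G)"
    and "maximal_subgroup H G" and "\<not> H \<lhd> G"
    and "is_dihedral (G\<lparr>carrier := H\<rparr>)" and "card H \<ge> 6"
  shows "relational_complexity G (\<lambda>C g. C #>\<^bsub>G\<^esub> g) (rcosets\<^bsub>G\<^esub> H) \<le> 3"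
proof (rule group.relational_complexity_rcosets_dihedral[OF assms(1,4,5,6)])
  fix N assume N: "N \<lhd> G" "N \<subseteq> H"
  have H: "H \<subseteq> carrier G" "H \<noteq> carrier G"
    using assms(4) by (auto simp: maximal_subgroup_def dest: subgroup.subset)
  show "N = {\<one>\<^bsub>G\<^esub>}"
  proof (rule ccontr)
    assume ne: "N \<noteq> {\<one>\<^bsub>G\<^esub>}"
    \<comment> \<open>A non-trivial normal \<open>N\<close> inside \<open>H\<close> is proper. This
      is impossible for simple \<open>G\<close>; otherwise \<open>N\<close> is maximal, so it equals
      \<open>H\<close>, which is not normal.\<close>
    have "N \<noteq> carrier G" using N H by auto
    then have "maximal_subgroup N G"
      using assms(3) N(1) ne simple_group.no_real_normal_subgroup by blast
    then have "H = N" using N(2) H assms(4) by (auto simp: maximal_subgroup_def)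
    then show False using N(1) assms(5) by simp
  qed
qed

end
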